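(* There is an absolute constant $C>0$ such that the following holds. Let $0<\delta\le 1$ and let $\mathcal{T}_1,\mathcal{T}_2,\mathcal{T}_3\subset\mathbb{C}^n$ be pairwise disjoint finite sets of nonzero vectors, such that any two distinct vectors in $\mathcal{T}_1\cup\mathcal{T}_2\cup\mathcal{T}_3$ are linearly independent, and such that $\mathcal{T}_1,\mathcal{T}_2,\mathcal{T}_3$ form a partial-$\delta$-EK configuration. Then $\dim\left(\mathrm{span}\left(\mathcal{T}_1\cup\mathcal{T}_2\cup\mathcal{T}_3\right)\right)\le C/\delta^3$.
   Context: Sets $\mathcal{T}_1,\mathcal{T}_2,\mathcal{T}_3\subset\mathbb{C}^n$ form a partial-$\delta$-EK configuration if for every $i\in[3]$ and every $p\in\mathcal{T}_i$, letting $\mathcal{T}_j$ be a set of maximum size among the two sets other than $\mathcal{T}_i$ and $\mathcal{T}_k$ the remaining set, at least a $\delta$ fraction of the vectors $p_j\in\mathcal{T}_j$ satisfy that $\mathrm{span}\{p,p_j\}$ contains some vector of $\mathcal{T}_k$. *)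

theory Defs
  imports Complex_Main "HOL-Library.Disjoint_Sets" "Jordan_Normal_Form.VS_Connect"
begin

text \<open>
  The ambient dimension n has to be an ordinary term, so that an absolute constant can be
  chosen before it. Hence the vectors of \<open>carrier_vec n\<close> are used and not a type \<open>complex ^ 'n\<close>.
\<close>

abbreviation cspace :: "nat \<Rightarrow> (complex, complex vec) module" where
  "cspace n \<equiv> module_vec TYPE(complex) n"

abbreviation cspan :: "nat \<Rightarrow> complex vec set \<Rightarrow> complex vec set" where
  "cspan n S \<equiv> LinearCombinations.module.span class_ring (cspace n) S"

abbreviation clin_indpt :: "nat \<Rightarrow> complex vec set \<Rightarrow> bool" where
  "clin_indpt n S \<equiv> \<not> LinearCombinations.module.lin_dep class_ring (cspace n) S"

abbreviation dim_cspan :: "nat \<Rightarrow> complex vec set \<Rightarrow> nat" where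
  "dim_cspan n S \<equiv> vectorspace.dim class_ring ((cspace n)\<lparr>carrier := cspan n S\<rparr>)"

text \<open>
  The three sets are \<open>T 1\<close>, \<open>T 2\<close>, \<open>T 3\<close>; the condition \<open>{i, j, k} = {1..3}\<close> forces the three
  indices to be distinct. If the two sets other than \<open>T i\<close> have equal size, either of them may
  serve as \<open>T j\<close>; this is the weakest reading of the notion.

  No fraction of an empty set counts as positive: for \<open>T j = {}\<close> the quotient below is
  \<open>0 / 0 = 0\<close>, so the inequality fails when \<open>\<delta> > 0\<close>. Otherwise a single linearly independent
  set together with two empty ones would be a configuration, and its span can have any
  dimension.
\<close>

definition partial_EK_configuration :: "nat \<Rightarrow> real \<Rightarrow> (nat \<Rightarrow> complex vec set) \<Rightarrow> bool" where
  "partial_EK_configuration n \<delta> T \<longleftrightarrow>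
     (\<forall>i\<in>{1..3}. \<forall>p\<in>T i. \<exists>j k. {i, j, k} = {1..3} \<and> card (T k) \<le> card (T j) \<and>
        real (card {q \<in> T j. \<exists>v\<in>T k. v \<in> cspan n {p, q}}) / real (card (T j)) \<ge> \<delta>)"

end

theory Submission
  imports Defs "Jordan_Normal_Form.DL_Rank"
begin

text \<open>
  Give a point of \<open>T i\<close> the weight \<open>min 1 (a / card (T i))\<close>, where \<open>a\<close> is the median of the three
  cardinalities. Each class then has total weight at most \<open>a\<close>, while for every point the special
  partners (those whose line through it meets the third class) weigh at least \<open>\<delta> a\<close>, and the
  third point on such a line has full weight 1. So unequal class sizes need no separate treatment,
  and the claim becomes a weighted Sylvester--Gallai bound.

  For that bound, a collinear triple on a line \<open>l\<close> gets the product of its three weights divided by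
  the weight of \<open>l\<close>. Then the triples through a pair \<open>i, j\<close> have total weight at most
  \<open>\<omega> i * \<omega> j\<close>, with a matching lower bound up to a constant for special pairs. The linear
  dependencies of the triples form a design matrix. After rescaling its rows and columns, the
  coordinates of the points are replaced by an isotropic system in its kernel; comparing the
  diagonal and off-diagonal parts of the Gram matrix of the rows bounds the dimension by
  \<open>O (1 / \<delta>\<^sup>2)\<close>.
\<close>

section \<open>Approximate matrix scaling\<close>

text \<open>
  Matrix scaling: \<open>w\<close> is a near-minimiser of
  \<open>\<Sum>t. r t * ln (\<Sum>i. a t i * w i) - \<Sum>j. k j * ln (w j)\<close>. If some column sum were below
  \<open>k j / 2\<close>, doubling \<open>w j\<close> would lower this function by at least \<open>k j * (ln 2 - 1/2)\<close>.
\<close>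

lemma approximate_scaling:
  fixes J :: "'a set" and R :: "'r set" and S :: "'r \<Rightarrow> 'a set"
    and a :: "'r \<Rightarrow> 'a \<Rightarrow> real" and r :: "'r \<Rightarrow> real" and k :: "'a \<Rightarrow> real"
  assumes fJ: "finite J" and fR: "finite R"
    and SJ: "\<And>t. t \<in> R \<Longrightarrow> S t \<subseteq> J" and Sne: "\<And>t. t \<in> R \<Longrightarrow> S t \<noteq> {}"
    and a: "\<And>t j. t \<in> R \<Longrightarrow> j \<in> S t \<Longrightarrow> a t j > 0"
    and r: "\<And>t. t \<in> R \<Longrightarrow> r t \<ge> 0"
    and k: "\<And>j. j \<in> J \<Longrightarrow> k j = (\<Sum>t\<in>{t\<in>R. j \<in> S t}. r t / card (S t))"
    and kpos: "\<And>j. j \<in> J \<Longrightarrow> k j > 0"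
  obtains w where "\<And>j. w j > 0"
    and "\<And>j. j \<in> J \<Longrightarrow>
      k j / 2 \<le> (\<Sum>t\<in>{t\<in>R. j \<in> S t}. r t * (a t j * w j / (\<Sum>i\<in>S t. a t i * w i)))"
proof -
  define s where "s t w = (\<Sum>i\<in>S t. a t i * w i)" for t and w :: "'a \<Rightarrow> real"
  define g where "g w = (\<Sum>t\<in>R. r t * ln (s t w)) - (\<Sum>j\<in>J. k j * ln (w j))" for w
  define P where "P = {w :: 'a \<Rightarrow> real. \<forall>j. w j > 0}"
  define c0 where "c0 = (\<Sum>t\<in>R. \<Sum>j\<in>S t. r t / card (S t) * ln (a t j))"
  have fS: "finite (S t)" if "t \<in> R" for t
    using SJ[OF that] fJ finite_subset by blast
  have s_ge: "a t j * w j \<le> s t w" if "t \<in> R" "j \<in> S t" "w \<in> P" for t j w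
    unfolding s_def
  proof (rule member_le_sum)
    show "j \<in> S t" "finite (S t)" using that fS by auto
    show "0 \<le> a t i * w i" if "i \<in> S t - {j}" for i
      using a \<open>t \<in> R\<close> \<open>w \<in> P\<close> that by (simp add: P_def less_imp_le)
  qed
  have s_pos: "s t w > 0" if t: "t \<in> R" and w: "w \<in> P" for t w
  proof -
    obtain j where j: "j \<in> S t" using Sne[OF t] by blast
    have "0 < a t j * w j" using a[OF t j] w by (simp add: P_def)
    also have "\<dots> \<le> s t w" by (rule s_ge[OF t j w])
    finally show ?thesis .
  qed
  \<comment> \<open>Each \<open>ln (s t w)\<close> is at least the uniform average over
    \<open>S t\<close> of \<open>ln (a t j * w j)\<close>. Summed over the rows,
    \<open>ln (w j)\<close> gets coefficient exactly \<open>k j\<close> and cancels against the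
    second sum of \<open>g\<close>, leaving the constant \<open>c0\<close>.\<close>
  have g_ge: "c0 \<le> g w" if w: "w \<in> P" for w
  proof -
    have row: "(\<Sum>j\<in>S t. r t / card (S t) * (ln (a t j) + ln (w j))) \<le> r t * ln (s t w)"
      if t: "t \<in> R" for t
    proof -
      have "(\<Sum>j\<in>S t. r t / card (S t) * (ln (a t j) + ln (w j)))
          \<le> (\<Sum>j\<in>S t. r t / card (S t) * ln (s t w))"
      proof (rule sum_mono, rule mult_left_mono)
        fix j assume j: "j \<in> S t"
        have p: "a t j > 0" "w j > 0" using a[OF t j] w by (auto simp: P_def)
        then have "ln (a t j) + ln (w j) = ln (a t j * w j)" by (simp add: ln_mult)
        also have "\<dots> \<le> ln (s t w)" using s_ge[OF t j w] s_pos[OF t w] p by simp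
        finally show "ln (a t j) + ln (w j) \<le> ln (s t w)" .
        show "0 \<le> r t / card (S t)" using r[OF t] by simp
      qed
      also have "\<dots> = r t * ln (s t w)" using fS[OF t] Sne[OF t] by simp
      finally show ?thesis .
    qed
    have "(\<Sum>j\<in>J. k j * ln (w j)) = (\<Sum>j\<in>J. \<Sum>t\<in>{t\<in>R. j \<in> S t}. r t / card (S t) * ln (w j))"
      by (rule sum.cong) (auto simp: k sum_distrib_right)
    also have "\<dots> = (\<Sum>t\<in>R. \<Sum>j\<in>{j\<in>J. j \<in> S t}. r t / card (S t) * ln (w j))"
      by (rule sum.swap_restrict[OF fJ fR])
    also have "\<dots> = (\<Sum>t\<in>R. \<Sum>j\<in>S t. r t / card (S t) * ln (w j))"
      using SJ by (intro sum.cong) auto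
    finally have eq: "(\<Sum>j\<in>J. k j * ln (w j)) = \<dots>" .
    have "c0 + (\<Sum>j\<in>J. k j * ln (w j))
        = (\<Sum>t\<in>R. \<Sum>j\<in>S t. r t / card (S t) * (ln (a t j) + ln (w j)))"
      unfolding eq c0_def by (simp only: sum.distrib distrib_left)
    also have "\<dots> \<le> (\<Sum>t\<in>R. r t * ln (s t w))" by (rule sum_mono) (rule row)
    finally show ?thesis by (simp add: g_def)
  qed
  \<comment> \<open>In a row whose support contains \<open>j\<close>, doubling \<open>w j\<close>
    multiplies \<open>s t w\<close> by \<open>1 + a t j * w j / s t w\<close>, and
    \<open>ln (1 + x) \<le> x\<close> bounds the growth. The second sum of \<open>g\<close> grows by
    exactly \<open>k j * ln 2\<close>.\<close>
  have step: "g (w(j := 2 * w j)) \<le> g w + (\<Sum>t\<in>{t\<in>R. j \<in> S t}. r t * (a t j * w j / s t w)) - k j * ln 2"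
    if j: "j \<in> J" and w: "w \<in> P" for j w
  proof -
    let ?w = "w(j := 2 * w j)"
    have "r t * ln (s t ?w) \<le> r t * ln (s t w) + (if j \<in> S t then r t * (a t j * w j / s t w) else 0)"
      if t: "t \<in> R" for t
    proof (cases "j \<in> S t")
      case True
      have "s t ?w = a t j * (2 * w j) + (\<Sum>i\<in>S t - {j}. a t i * w i)"
        unfolding s_def by (subst sum.remove[OF fS[OF t] True]) auto
      also have "\<dots> = a t j * w j + s t w"
        unfolding s_def using sum.remove[OF fS[OF t] True, of "\<lambda>i. a t i * w i"] by simp
      finally have eq: "s t ?w = s t w * (1 + a t j * w j / s t w)"
        using s_pos[OF t w] by (simp add: field_simps)
      have nn: "0 \<le> a t j * w j / s t w"
        using s_pos[OF t w] a[OF t True] w by (simp add: P_def less_imp_le)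
      then have "ln (s t ?w) = ln (s t w) + ln (1 + a t j * w j / s t w)"
        unfolding eq using s_pos[OF t w] by (subst ln_mult) auto
      also have "\<dots> \<le> ln (s t w) + a t j * w j / s t w"
        using ln_add_one_self_le_self[OF nn] by simp
      finally show ?thesis using True mult_left_mono[OF _ r[OF t]] by (fastforce simp: distrib_left)
    next
      case False
      then have "s t ?w = s t w" unfolding s_def by (intro sum.cong) auto
      then show ?thesis using False by simp
    qed
    then have "(\<Sum>t\<in>R. r t * ln (s t ?w))
        \<le> (\<Sum>t\<in>R. r t * ln (s t w) + (if j \<in> S t then r t * (a t j * w j / s t w) else 0))"
      by (rule sum_mono)
    also have "\<dots> = (\<Sum>t\<in>R. r t * ln (s t w)) + (\<Sum>t\<in>{t\<in>R. j \<in> S t}. r t * (a t j * w j / s t w))"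
      by (simp only: sum.distrib sum.inter_filter[OF fR])
    finally have 1: "(\<Sum>t\<in>R. r t * ln (s t ?w)) \<le> \<dots>" .
    have wj: "w j > 0" using w by (simp add: P_def)
    have "(\<Sum>i\<in>J. k i * ln (?w i)) = k j * ln (2 * w j) + (\<Sum>i\<in>J - {j}. k i * ln (w i))"
      by (subst sum.remove[OF fJ j]) auto
    also have "\<dots> = k j * ln 2 + (\<Sum>i\<in>J. k i * ln (w i))"
      using wj sum.remove[OF fJ j, of "\<lambda>i. k i * ln (w i)"] by (simp add: ln_mult distrib_left)
    finally show ?thesis using 1 by (simp add: g_def)
  qed
  have ln2: "ln 2 > (1/2 :: real)"
  proof -
    have "1 \<le> ln (3::real)" using exp_le by (simp add: ln_ge_iff)
    also have "\<dots> < ln (2 * 2)" by simp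
    also have "\<dots> = ln 2 + ln (2::real)" by (subst ln_mult) simp_all
    finally show ?thesis by simp
  qed
  \<comment> \<open>The infimum of \<open>g\<close> need not be attained, so \<open>w\<close> is
    only taken within \<open>\<epsilon>\<close> of it. That is close enough:
    \<open>\<epsilon>\<close> is at most the gain from doubling the weight of any deficient
    column.\<close>
  obtain \<epsilon> where e: "\<epsilon> > 0" "\<And>j. j \<in> J \<Longrightarrow> \<epsilon> \<le> k j * (ln 2 - 1/2)"
  proof (cases "J = {}")
    case True then show thesis using that[of 1] by auto
  next
    case False
    show thesis
    proof (rule that)
      show "Min ((\<lambda>j. k j * (ln 2 - 1/2)) ` J) > 0" using False fJ kpos ln2 by simp
      show "Min ((\<lambda>j. k j * (ln 2 - 1/2)) ` J) \<le> k j * (ln 2 - 1/2)" if "j \<in> J" for j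
        by (rule Min_le) (use that fJ in auto)
    qed
  qed
  have bdd: "bdd_below (g ` P)" by (rule bdd_belowI2[of P c0 g]) (rule g_ge)
  have "g ` P \<noteq> {}" by (auto simp: P_def intro: exI[of _ "\<lambda>_. 1"])
  moreover have "Inf (g ` P) < Inf (g ` P) + \<epsilon>" using e by simp
  ultimately have "\<exists>y\<in>g ` P. y < Inf (g ` P) + \<epsilon>" by (rule cInf_lessD)
  then obtain w where w: "w \<in> P" and gw: "g w < Inf (g ` P) + \<epsilon>" by blast
  show thesis
  proof (rule that)
    show "w j > 0" for j using w by (simp add: P_def)
    fix j assume j: "j \<in> J"
    have "w(j := 2 * w j) \<in> P" using w by (auto simp: P_def)
    then have "Inf (g ` P) \<le> g (w(j := 2 * w j))" using bdd by (intro cInf_lower) auto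
    with step[OF j w] gw e(2)[OF j]
    show "k j / 2 \<le> (\<Sum>t\<in>{t\<in>R. j \<in> S t}. r t * (a t j * w j / (\<Sum>i\<in>S t. a t i * w i)))"
      unfolding s_def by (simp add: algebra_simps)
  qed
qed

section \<open>Gram--Schmidt for a weighted inner product\<close>

text \<open>
  The points \<open>b m\<close> make the system \<open>f\<close> triangular, which keeps every vector of the Gram--Schmidt
  process nonzero.
\<close>

lemma gram_schmidt_weighted:
  fixes J :: "'a set" and k :: "'a \<Rightarrow> real" and f :: "nat \<Rightarrow> 'a \<Rightarrow> complex" and b :: "nat \<Rightarrow> 'a"
  assumes fJ: "finite J" and k: "\<And>j. j \<in> J \<Longrightarrow> k j > 0"
    and b: "\<And>m. m < d \<Longrightarrow> b m \<in> J"
    and diag: "\<And>m. m < d \<Longrightarrow> f m (b m) \<noteq> 0"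
    and off: "\<And>m l. m < d \<Longrightarrow> l < d \<Longrightarrow> m < l \<Longrightarrow> f m (b l) = 0"
    and W: "\<And>m. m < d \<Longrightarrow> f m \<in> W"
    and add: "\<And>u v. u \<in> W \<Longrightarrow> v \<in> W \<Longrightarrow> (\<lambda>j. u j + v j) \<in> W"
    and scale: "\<And>c u. u \<in> W \<Longrightarrow> (\<lambda>j. c * u j) \<in> W"
  shows "\<exists>e. (\<forall>m<d. e m \<in> W) \<and>
    (\<forall>m<d. \<forall>l<d. (\<Sum>j\<in>J. k j * (e m j * cnj (e l j))) = (if m = l then 1 else 0))"
proof -
  let ?ip = "\<lambda>u v. \<Sum>j\<in>J. complex_of_real (k j) * (u j * cnj (v j))"
  \<comment> \<open>The middle clause carries the induction: the vectors built so far vanish at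
    \<open>b n\<close>, so subtracting projections leaves the value \<open>f n (b n)\<close> intact
    and the new vector \<open>u\<close> has positive norm.\<close>
  have "\<exists>e. (\<forall>m<n. e m \<in> W) \<and> (\<forall>m<n. \<forall>l. n \<le> l \<and> l < d \<longrightarrow> e m (b l) = 0) \<and>
    (\<forall>m<n. \<forall>l<n. ?ip (e m) (e l) = (if m = l then 1 else 0))" if "n \<le> d" for n
    using that
  proof (induction n)
    case 0 then show ?case by simp
  next
    case (Suc n)
    then have "\<exists>e. (\<forall>m<n. e m \<in> W) \<and> (\<forall>m<n. \<forall>l. n \<le> l \<and> l < d \<longrightarrow> e m (b l) = 0) \<and>
      (\<forall>m<n. \<forall>l<n. ?ip (e m) (e l) = (if m = l then 1 else 0))" by simp
    then obtain e where eW: "\<And>m. m < n \<Longrightarrow> e m \<in> W"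
      and e0: "\<And>m l. m < n \<Longrightarrow> n \<le> l \<Longrightarrow> l < d \<Longrightarrow> e m (b l) = 0"
      and eo: "\<And>m l. m < n \<Longrightarrow> l < n \<Longrightarrow> ?ip (e m) (e l) = (if m = l then 1 else 0)"
      by blast
    have nd: "n < d" using Suc by simp
    define x where "x m = - ?ip (f n) (e m)" for m
    define u where "u j = f n j + (\<Sum>m<n. x m * e m j)" for j
    have "(\<lambda>j. f n j + (\<Sum>m<p. x m * e m j)) \<in> W" if "p \<le> n" for p
      using that
    proof (induction p)
      case 0 then show ?case using W[OF nd] by simp
    next
      case (Suc p)
      then have "(\<lambda>j. (f n j + (\<Sum>m<p. x m * e m j)) + x p * e p j) \<in> W"
        by (intro add[OF _ scale[OF eW]]) auto
      then show ?case by (simp add: add.assoc)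
    qed
    then have uW: "u \<in> W" unfolding u_def[abs_def] by blast
    have ul: "u (b l) = f n (b l)" if "n \<le> l" "l < d" for l
      unfolding u_def using e0 that by simp
    have uo: "?ip u (e l) = 0" if l: "l < n" for l
    proof -
      have "?ip u (e l) = ?ip (f n) (e l) + (\<Sum>j\<in>J. \<Sum>m<n. x m * (k j * (e m j * cnj (e l j))))"
        unfolding u_def
        by (simp add: distrib_left distrib_right sum.distrib sum_distrib_left sum_distrib_right mult_ac)
      also have "(\<Sum>j\<in>J. \<Sum>m<n. x m * (k j * (e m j * cnj (e l j)))) = (\<Sum>m<n. x m * ?ip (e m) (e l))"
        by (subst sum.swap) (simp only: sum_distrib_left)
      also have "\<dots> = (\<Sum>m<n. if m = l then x m else 0)"
        by (rule sum.cong) (auto simp: eo l)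
      also have "\<dots> = - ?ip (f n) (e l)" using l by (simp add: x_def)
      finally show ?thesis by simp
    qed
    define N where "N = (\<Sum>j\<in>J. k j * (cmod (u j))\<^sup>2)"
    have N: "?ip u u = complex_of_real N"
      unfolding N_def of_real_sum
      by (intro sum.cong refl) (simp only: of_real_mult complex_norm_square)
    have "0 < k (b n) * (cmod (u (b n)))\<^sup>2"
      using ul[of n] nd diag[OF nd] k[OF b[OF nd]] by simp
    also have "\<dots> \<le> N" unfolding N_def
      by (rule member_le_sum) (use fJ b[OF nd] k in \<open>auto simp: less_imp_le\<close>)
    finally have Np: "N > 0" .
    define v where "v j = complex_of_real (1 / sqrt N) * u j" for j
    have vW: "v \<in> W" unfolding v_def[abs_def] by (rule scale[OF uW])
    have vv: "?ip v v = 1"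
    proof -
      have "?ip v v = complex_of_real (1 / sqrt N * (1 / sqrt N)) * ?ip u u"
        unfolding v_def sum_distrib_left
        by (intro sum.cong refl)
          (simp only: complex_cnj_mult complex_cnj_complex_of_real of_real_mult mult_ac)
      also have "\<dots> = 1" unfolding N using Np by (simp flip: of_real_mult)
      finally show ?thesis .
    qed
    have ve: "?ip v (e l) = 0" if "l < n" for l
    proof -
      have "?ip v (e l) = complex_of_real (1 / sqrt N) * ?ip u (e l)"
        unfolding v_def sum_distrib_left by (intro sum.cong refl) (simp add: mult_ac)
      then show ?thesis using uo[OF that] by simp
    qed
    have ev: "?ip (e l) v = 0" if "l < n" for l
    proof -
      have "?ip (e l) v = cnj (?ip v (e l))"
        unfolding cnj_sum by (intro sum.cong refl) (simp add: mult_ac)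
      then show ?thesis using ve[OF that] by simp
    qed
    show ?case
    proof (intro exI[of _ "e(n := v)"] conjI allI impI)
      show "(e(n := v)) m \<in> W" if "m < Suc n" for m using that eW vW by auto
      show "(e(n := v)) m (b l) = 0" if "m < Suc n" "Suc n \<le> l \<and> l < d" for m l
        using that e0[of m l] ul[of l] off[of n l] nd by (auto simp: v_def)
      show "?ip ((e(n := v)) m) ((e(n := v)) l) = (if m = l then 1 else 0)"
        if "m < Suc n" "l < Suc n" for m l
        using that eo[of m l] vv ve[of l] ev[of m] by (cases "m = n"; cases "l = n") auto
    qed
  qed
  from this[of d] show ?thesis by auto
qed

section \<open>Kernel dimension of design matrices\<close>

text \<open>
  \<open>f\<close> lists \<open>d\<close> independent vectors in the kernel of the matrix \<open>\<alpha>\<close>, whose row \<open>t\<close> has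
  support \<open>S t\<close> and weight \<open>r t\<close>.
\<close>

lemma design_bound:
  fixes J :: "'a set" and R :: "'r set" and S :: "'r \<Rightarrow> 'a set"
    and \<alpha> :: "'r \<Rightarrow> 'a \<Rightarrow> complex" and r :: "'r \<Rightarrow> real" and k :: "'a \<Rightarrow> real"
    and f :: "nat \<Rightarrow> 'a \<Rightarrow> complex" and b :: "nat \<Rightarrow> 'a" and \<kappa> :: real
  assumes fJ: "finite J" and fR: "finite R"
    and SJ: "\<And>t. t \<in> R \<Longrightarrow> S t \<subseteq> J" and Sne: "\<And>t. t \<in> R \<Longrightarrow> S t \<noteq> {}"
    and \<alpha>: "\<And>t j. t \<in> R \<Longrightarrow> j \<in> S t \<Longrightarrow> \<alpha> t j \<noteq> 0"
    and r: "\<And>t. t \<in> R \<Longrightarrow> r t > 0"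
    and k: "\<And>j. j \<in> J \<Longrightarrow> k j = (\<Sum>t\<in>{t\<in>R. j \<in> S t}. r t / card (S t))"
    and kpos: "\<And>j. j \<in> J \<Longrightarrow> k j > 0"
    and \<kappa>: "\<kappa> > 0"
    and pair: "\<And>i j. i \<in> J \<Longrightarrow> j \<in> J \<Longrightarrow> i \<noteq> j \<Longrightarrow>
      (\<Sum>t\<in>{t\<in>R. i \<in> S t \<and> j \<in> S t}. r t) \<le> \<kappa> * (k i * k j)"
    and rel: "\<And>m t. m < d \<Longrightarrow> t \<in> R \<Longrightarrow> (\<Sum>j\<in>S t. \<alpha> t j * f m j) = 0"
    and b: "\<And>m. m < d \<Longrightarrow> b m \<in> J"
    and diag: "\<And>m. m < d \<Longrightarrow> f m (b m) \<noteq> 0"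
    and off: "\<And>m l. m < d \<Longrightarrow> l < d \<Longrightarrow> m < l \<Longrightarrow> f m (b l) = 0"
  shows "real d \<le> 4 * \<kappa> * (\<Sum>t\<in>R. r t)"
proof -
  have fS: "finite (S t)" if "t \<in> R" for t
    using SJ[OF that] fJ finite_subset by blast
  obtain w where w: "\<And>j. w j > 0" and kw: "\<And>j. j \<in> J \<Longrightarrow> k j / 2 \<le>
      (\<Sum>t\<in>{t\<in>R. j \<in> S t}. r t * ((cmod (\<alpha> t j))\<^sup>2 * w j / (\<Sum>i\<in>S t. (cmod (\<alpha> t i))\<^sup>2 * w i)))"
    by (rule approximate_scaling[OF fJ fR SJ Sne _ _ k kpos, of "\<lambda>t j. (cmod (\<alpha> t j))\<^sup>2"])
      (use \<alpha> r in \<open>auto simp: less_imp_le\<close>)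
  define s where "s t = (\<Sum>i\<in>S t. (cmod (\<alpha> t i))\<^sup>2 * w i)" for t
  have s: "s t > 0" if t: "t \<in> R" for t
    unfolding s_def by (rule sum_pos) (use fS Sne \<alpha> w t in auto)
  \<comment> \<open>The rescaled matrix: the squared moduli in row \<open>t\<close> add up to
    exactly \<open>r t\<close>, those in column \<open>j\<close> to at least
    \<open>k j / 2\<close>.\<close>
  define A where "A t j = (if j \<in> S t then \<alpha> t j * of_real (sqrt (w j) * sqrt (r t / s t)) else 0)" for t j
  have A2: "(cmod (A t j))\<^sup>2 = (if j \<in> S t then r t * ((cmod (\<alpha> t j))\<^sup>2 * w j / s t) else 0)"
    if t: "t \<in> R" for t j
    using s[OF t] r[OF t] w[of j] by (auto simp: A_def norm_mult power_mult_distrib)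
  have rowA: "(\<Sum>j\<in>J. (cmod (A t j))\<^sup>2) = r t" if t: "t \<in> R" for t
  proof -
    have "(\<Sum>j\<in>J. (cmod (A t j))\<^sup>2) = (\<Sum>j\<in>S t. (cmod (A t j))\<^sup>2)"
      by (rule sum.mono_neutral_right) (use fJ SJ t in \<open>auto simp: A_def\<close>)
    also have "\<dots> = (\<Sum>j\<in>S t. r t / s t * ((cmod (\<alpha> t j))\<^sup>2 * w j))"
      by (rule sum.cong) (auto simp: A2[OF t])
    also have "\<dots> = r t / s t * s t" unfolding s_def sum_distrib_left ..
    finally show ?thesis using s[OF t] by simp
  qed
  define c where "c j = (\<Sum>t\<in>R. (cmod (A t j))\<^sup>2)" for j
  have c: "k j / 2 \<le> c j" if j: "j \<in> J" for j
  proof -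
    have "c j = (\<Sum>t\<in>R. if j \<in> S t then r t * ((cmod (\<alpha> t j))\<^sup>2 * w j / s t) else 0)"
      unfolding c_def by (rule sum.cong) (auto simp: A2)
    then show ?thesis using kw[OF j] by (simp only: sum.inter_filter[OF fR] s_def)
  qed
  have cpos: "c j > 0" if "j \<in> J" for j using c[OF that] kpos[OF that] by simp
  \<comment> \<open>\<open>W\<close> is the kernel of \<open>A\<close>. Since column
    \<open>j\<close> was multiplied by \<open>sqrt (w j)\<close>, kernel vectors of the original
    matrix enter it after division by \<open>sqrt (w j)\<close>; this keeps the triangular pattern
    at the points \<open>b m\<close>.\<close>
  define W where "W = {u. \<forall>t\<in>R. (\<Sum>j\<in>J. A t j * u j) = 0}"
  have fW: "(\<lambda>j. f m j / of_real (sqrt (w j))) \<in> W" if m: "m < d" for m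
    unfolding W_def
  proof (intro CollectI ballI)
    fix t assume t: "t \<in> R"
    have "(\<Sum>j\<in>J. A t j * (f m j / of_real (sqrt (w j))))
        = (\<Sum>j\<in>S t. A t j * (f m j / of_real (sqrt (w j))))"
      by (rule sum.mono_neutral_right) (use fJ SJ t in \<open>auto simp: A_def\<close>)
    also have "\<dots> = (\<Sum>j\<in>S t. of_real (sqrt (r t / s t)) * (\<alpha> t j * f m j))"
      by (rule sum.cong) (use w in \<open>auto simp: A_def less_imp_neq[symmetric]\<close>)
    also have "\<dots> = 0" using rel[OF m t] by (simp flip: sum_distrib_left)
    finally show "(\<Sum>j\<in>J. A t j * (f m j / of_real (sqrt (w j)))) = 0" .
  qed
  have "\<exists>e. (\<forall>m<d. e m \<in> W) \<and>
    (\<forall>m<d. \<forall>l<d. (\<Sum>j\<in>J. c j * (e m j * cnj (e l j))) = (if m = l then 1 else 0))"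
  proof (rule gram_schmidt_weighted[OF fJ cpos b _ _ fW])
    show "f m (b m) / of_real (sqrt (w (b m))) \<noteq> 0" if "m < d" for m
      using diag[OF that] w[of "b m"] by simp
    show "f m (b l) / of_real (sqrt (w (b l))) = 0" if "m < d" "l < d" "m < l" for m l
      using off[OF that] by simp
    show "(\<lambda>j. u j + v j) \<in> W" if "u \<in> W" "v \<in> W" for u v
      using that by (simp add: W_def distrib_left sum.distrib)
    show "(\<lambda>j. x * u j) \<in> W" if "u \<in> W" for x u
      using that by (simp add: W_def mult.left_commute flip: sum_distrib_left)
  qed
  then obtain e where eW: "\<And>m t. m < d \<Longrightarrow> t \<in> R \<Longrightarrow> (\<Sum>j\<in>J. A t j * e m j) = 0"
    and eo: "\<And>m l. m < d \<Longrightarrow> l < d \<Longrightarrow> (\<Sum>j\<in>J. c j * (e m j * cnj (e l j))) = (if m = l then 1 else 0)"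
    unfolding W_def by blast
  \<comment> \<open>\<open>G\<close> is the Gram matrix of the points in the isotropic position given by \<open>e\<close>. The rows being
    orthogonal to \<open>e\<close>, the diagonal part of \<open>A\<^sup>* A\<close> paired with \<open>G\<close>, which equals \<open>d\<close>,
    cancels against the off-diagonal part.\<close>
  define G where "G i j = (\<Sum>m<d. e m i * cnj (e m j))" for i j
  have G1: "(\<Sum>j\<in>J. c j * G j j) = of_nat d"
  proof -
    have "(\<Sum>j\<in>J. c j * G j j) = (\<Sum>m<d. \<Sum>j\<in>J. c j * (e m j * cnj (e m j)))"
      unfolding G_def sum_distrib_left by (rule sum.swap)
    also have "\<dots> = (\<Sum>m<d. 1)" by (rule sum.cong) (auto simp: eo)
    finally show ?thesis by simp
  qed
  \<comment> \<open>The matrix with entries \<open>sqrt (c i * c j) * G i j\<close> is an orthogonal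
    projection of rank \<open>d\<close>, so its squared Frobenius norm equals its trace, computed in
    \<open>G1\<close>.\<close>
  have G2: "(\<Sum>i\<in>J. \<Sum>j\<in>J. c i * c j * (cmod (G i j))\<^sup>2) = d"
  proof -
    let ?h = "\<lambda>(i, j) (m, l). (c i * (e m i * cnj (e l i))) * (c j * (e l j * cnj (e m j)))"
    have eo': "(\<Sum>i\<in>J. \<Sum>j\<in>J. ?h (i, j) (m, l)) = (if m = l then 1 else 0)"
      if "m < d" "l < d" for m l
    proof -
      have "(\<Sum>i\<in>J. \<Sum>j\<in>J. ?h (i, j) (m, l))
          = (\<Sum>j\<in>J. c j * (e m j * cnj (e l j))) * (\<Sum>j\<in>J. c j * (e l j * cnj (e m j)))"
        by (simp only: sum_product prod.case)
      also have "\<dots> = (if m = l then 1 else 0)" by (simp add: eo that)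
      finally show ?thesis .
    qed
    have "complex_of_real (\<Sum>i\<in>J. \<Sum>j\<in>J. c i * c j * (cmod (G i j))\<^sup>2)
        = (\<Sum>i\<in>J. \<Sum>j\<in>J. c i * c j * (G i j * cnj (G i j)))"
      by (simp only: of_real_sum of_real_mult complex_norm_square[symmetric])
    also have "\<dots> = (\<Sum>i\<in>J. \<Sum>j\<in>J. \<Sum>m<d. \<Sum>l<d. ?h (i, j) (m, l))"
    proof (intro sum.cong refl)
      fix i j
      have "G i j * cnj (G i j) = (\<Sum>m<d. \<Sum>l<d. e m i * cnj (e m j) * (cnj (e l i) * e l j))"
        by (simp add: G_def sum_product)
      then show "c i * c j * (G i j * cnj (G i j)) = (\<Sum>m<d. \<Sum>l<d. ?h (i, j) (m, l))"
        by (simp add: sum_distrib_left mult_ac)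
    qed
    also have "\<dots> = (\<Sum>x\<in>J \<times> J. \<Sum>y\<in>{..<d} \<times> {..<d}. ?h x y)"
      by (simp add: sum.cartesian_product')
    also have "\<dots> = (\<Sum>y\<in>{..<d} \<times> {..<d}. \<Sum>x\<in>J \<times> J. ?h x y)"
      by (rule sum.swap)
    also have "\<dots> = (\<Sum>m<d. \<Sum>l<d. \<Sum>i\<in>J. \<Sum>j\<in>J. ?h (i, j) (m, l))"
      by (simp add: sum.cartesian_product')
    also have "\<dots> = (\<Sum>m<d. \<Sum>l<d. if m = l then 1 else 0)"
      by (intro sum.cong refl eo') auto
    also have "\<dots> = complex_of_real d" by simp
    finally show ?thesis by (simp only: of_real_eq_iff)
  qed
  \<comment> \<open>The double sum is the sum over \<open>m\<close> of the squared moduli of row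
    \<open>t\<close> applied to \<open>e m\<close>.\<close>
  have G0: "(\<Sum>i\<in>J. \<Sum>j\<in>J. A t i * cnj (A t j) * G i j) = 0" if t: "t \<in> R" for t
  proof -
    have "(\<Sum>i\<in>J. \<Sum>j\<in>J. A t i * cnj (A t j) * G i j)
        = (\<Sum>x\<in>J \<times> J. \<Sum>m<d. case x of (i, j) \<Rightarrow> (A t i * e m i) * cnj (A t j * e m j))"
      by (simp add: sum.cartesian_product' G_def sum_distrib_left mult_ac)
    also have "\<dots> = (\<Sum>m<d. (\<Sum>i\<in>J. A t i * e m i) * cnj (\<Sum>j\<in>J. A t j * e m j))"
      by (subst sum.swap) (simp add: cnj_sum sum_product sum.cartesian_product')
    also have "\<dots> = 0" using eW t by simp
    finally show ?thesis .
  qed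
  define \<rho> where "\<rho> t i j = (if i \<in> S t \<and> j \<in> S t then r t else 0)" for t i j
  let ?B = "\<lambda>t i. (cmod (A t i))\<^sup>2"
  \<comment> \<open>This is \<open>2 * (x * y) \<le> x\<^sup>2 + y\<^sup>2\<close>, balanced so that
    the second terms add up to at most \<open>d\<close>. Starting from \<open>2 * d\<close> on the
    left, one \<open>d\<close> is absorbed, and the first terms give \<open>4 * \<kappa>\<close>
    times the sum of \<open>r\<close>.\<close>
  have entry: "2 * cmod (A t i * cnj (A t j) * G i j)
      \<le> 4 * \<kappa> * (?B t i * ?B t j / r t) + \<rho> t i j * (cmod (G i j))\<^sup>2 / (4 * \<kappa>)" if t: "t \<in> R" for t i j
  proof (cases "i \<in> S t \<and> j \<in> S t")
    case True
    define x y where "x = 2 * sqrt \<kappa> * (cmod (A t i) * cmod (A t j)) / sqrt (r t)"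
      and "y = sqrt (r t) * cmod (G i j) / (2 * sqrt \<kappa>)"
    have "2 * (x * y) \<le> x\<^sup>2 + y\<^sup>2" using sum_squares_bound[of x y] by (simp add: mult.assoc)
    moreover have "x * y = cmod (A t i * cnj (A t j) * G i j)"
      using r[OF t] \<kappa> by (simp add: x_def y_def norm_mult)
    moreover have "x\<^sup>2 = 4 * \<kappa> * (?B t i * ?B t j / r t)"
      using r[OF t] \<kappa> by (simp add: x_def power_mult_distrib power_divide)
    moreover have "y\<^sup>2 = \<rho> t i j * (cmod (G i j))\<^sup>2 / (4 * \<kappa>)"
      using r[OF t] \<kappa> True by (simp add: y_def \<rho>_def power_mult_distrib power_divide)
    ultimately show ?thesis by simp
  next
    case False
    then have "A t i * cnj (A t j) = 0" by (auto simp: A_def)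
    then show ?thesis using r[OF t] \<kappa> False by (auto simp: \<rho>_def)
  qed
  have "complex_of_real d = (\<Sum>t\<in>R. \<Sum>j\<in>J. A t j * cnj (A t j) * G j j)"
  proof -
    have "(\<Sum>t\<in>R. \<Sum>j\<in>J. A t j * cnj (A t j) * G j j) = (\<Sum>j\<in>J. \<Sum>t\<in>R. A t j * cnj (A t j) * G j j)"
      by (rule sum.swap)
    also have "\<dots> = (\<Sum>j\<in>J. c j * G j j)"
      unfolding c_def of_real_sum sum_distrib_right complex_norm_square ..
    finally show ?thesis using G1 by simp
  qed
  also have "\<dots> = (\<Sum>t\<in>R. - (\<Sum>i\<in>J. \<Sum>j\<in>J - {i}. A t i * cnj (A t j) * G i j))"
  proof (rule sum.cong[OF refl])
    fix t assume t: "t \<in> R"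
    have "0 = (\<Sum>i\<in>J. A t i * cnj (A t i) * G i i + (\<Sum>j\<in>J - {i}. A t i * cnj (A t j) * G i j))"
      unfolding G0[OF t, symmetric] by (intro sum.cong refl sum.remove fJ)
    then show "(\<Sum>j\<in>J. A t j * cnj (A t j) * G j j)
        = - (\<Sum>i\<in>J. \<Sum>j\<in>J - {i}. A t i * cnj (A t j) * G i j)"
      unfolding sum.distrib by (simp add: eq_neg_iff_add_eq_0)
  qed
  finally have "real d = cmod \<dots>" by (metis norm_of_nat of_real_of_nat_eq)
  also have "\<dots> \<le> (\<Sum>t\<in>R. \<Sum>i\<in>J. \<Sum>j\<in>J - {i}. cmod (A t i * cnj (A t j) * G i j))"
    by (intro sum_norm_le order_trans[OF eq_refl[OF norm_minus_cancel]]) auto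
  finally have "2 * real d \<le> (\<Sum>t\<in>R. \<Sum>i\<in>J. \<Sum>j\<in>J - {i}. 2 * cmod (A t i * cnj (A t j) * G i j))"
    by (simp flip: sum_distrib_left)
  also have "\<dots> \<le> (\<Sum>t\<in>R. \<Sum>i\<in>J. \<Sum>j\<in>J - {i}.
      4 * \<kappa> * (?B t i * ?B t j / r t) + \<rho> t i j * (cmod (G i j))\<^sup>2 / (4 * \<kappa>))"
    by (intro sum_mono entry)
  also have "\<dots> = (\<Sum>t\<in>R. \<Sum>i\<in>J. \<Sum>j\<in>J - {i}. 4 * \<kappa> * (?B t i * ?B t j / r t))
      + (\<Sum>t\<in>R. \<Sum>i\<in>J. \<Sum>j\<in>J - {i}. \<rho> t i j * (cmod (G i j))\<^sup>2 / (4 * \<kappa>))"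
    by (simp only: sum.distrib)
  also have "(\<Sum>t\<in>R. \<Sum>i\<in>J. \<Sum>j\<in>J - {i}. 4 * \<kappa> * (?B t i * ?B t j / r t)) \<le> (\<Sum>t\<in>R. 4 * \<kappa> * r t)"
  proof (rule sum_mono)
    fix t assume t: "t \<in> R"
    have "(\<Sum>i\<in>J. \<Sum>j\<in>J - {i}. 4 * \<kappa> * (?B t i * ?B t j / r t))
        \<le> (\<Sum>i\<in>J. \<Sum>j\<in>J. 4 * \<kappa> * (?B t i * ?B t j / r t))"
      using r[OF t] \<kappa> by (intro sum_mono sum_mono2 fJ) auto
    also have "\<dots> = 4 * \<kappa> / r t * ((\<Sum>i\<in>J. ?B t i) * (\<Sum>j\<in>J. ?B t j))"
      unfolding sum_product by (simp add: sum_distrib_left)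
    also have "\<dots> = 4 * \<kappa> * r t" using r[OF t] by (simp add: rowA[OF t])
    finally show "(\<Sum>i\<in>J. \<Sum>j\<in>J - {i}. 4 * \<kappa> * (?B t i * ?B t j / r t)) \<le> 4 * \<kappa> * r t" .
  qed
  also have "(\<Sum>t\<in>R. \<Sum>i\<in>J. \<Sum>j\<in>J - {i}. \<rho> t i j * (cmod (G i j))\<^sup>2 / (4 * \<kappa>)) \<le> d"
  proof -
    have "(\<Sum>t\<in>R. \<Sum>i\<in>J. \<Sum>j\<in>J - {i}. \<rho> t i j * (cmod (G i j))\<^sup>2 / (4 * \<kappa>))
        = (\<Sum>i\<in>J. \<Sum>t\<in>R. \<Sum>j\<in>J - {i}. \<rho> t i j * (cmod (G i j))\<^sup>2 / (4 * \<kappa>))"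
      by (rule sum.swap)
    also have "\<dots> = (\<Sum>i\<in>J. \<Sum>j\<in>J - {i}. \<Sum>t\<in>R. \<rho> t i j * (cmod (G i j))\<^sup>2 / (4 * \<kappa>))"
      by (intro sum.cong refl sum.swap)
    \<comment> \<open>The pair condition is stated for \<open>k\<close>, while \<open>G2\<close>
      involves \<open>c\<close>. Each of the two columns loses a factor 2 in
      \<open>k j / 2 \<le> c j\<close>, which the denominator \<open>4 * \<kappa>\<close>
      compensates.\<close>
    also have "\<dots> \<le> (\<Sum>i\<in>J. \<Sum>j\<in>J - {i}. c i * c j * (cmod (G i j))\<^sup>2)"
    proof (intro sum_mono)
      fix i j assume i: "i \<in> J" and j: "j \<in> J - {i}"
      have "(\<Sum>t\<in>R. \<rho> t i j) = (\<Sum>t\<in>{t\<in>R. i \<in> S t \<and> j \<in> S t}. r t)"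
        unfolding \<rho>_def by (rule sum.inter_filter[OF fR, symmetric])
      also have "\<dots> \<le> \<kappa> * (k i * k j)" using pair i j by auto
      also have "\<dots> \<le> \<kappa> * ((2 * c i) * (2 * c j))"
        using c[OF i] c[of j] kpos[OF i] kpos[of j] \<kappa> i j
        by (intro mult_left_mono mult_mono) auto
      finally have "(\<Sum>t\<in>R. \<rho> t i j) / (4 * \<kappa>) \<le> c i * c j" using \<kappa> by (simp add: field_simps)
      then have "(\<Sum>t\<in>R. \<rho> t i j) / (4 * \<kappa>) * (cmod (G i j))\<^sup>2 \<le> c i * c j * (cmod (G i j))\<^sup>2"
        by (rule mult_right_mono) simp
      then show "(\<Sum>t\<in>R. \<rho> t i j * (cmod (G i j))\<^sup>2 / (4 * \<kappa>)) \<le> c i * c j * (cmod (G i j))\<^sup>2"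
        by (simp add: sum_distrib_right sum_divide_distrib)
    qed
    also have "\<dots> \<le> (\<Sum>i\<in>J. \<Sum>j\<in>J. c i * c j * (cmod (G i j))\<^sup>2)"
      using cpos by (intro sum_mono sum_mono2 fJ) (auto simp: less_imp_le)
    finally show ?thesis using G2 by simp
  qed
  finally show ?thesis by (simp add: sum_distrib_left)
qed

section \<open>Weighted Sylvester--Gallai bound\<close>

text \<open>\<open>L i j\<close> is the set of points on the line through \<open>i\<close> and
  \<open>j\<close>, and the bracket in \<open>rich\<close> is the fraction of its weight lying off
  these two points. Collinear triples serve as rows of a design matrix whose kernel contains the
  \<open>d\<close> coordinate functions; at the points \<open>b\<close> these form an identity
  block, hence a triangular system.\<close>

lemma weighted_Sylvester_Gallai:
  fixes J :: "'a set" and \<phi> :: "'a \<Rightarrow> nat \<Rightarrow> complex" and \<omega> :: "'a \<Rightarrow> real" and b :: "nat \<Rightarrow> 'a"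
    and L :: "'a \<Rightarrow> 'a \<Rightarrow> 'a set" and \<delta> :: real
  assumes L_def: "\<And>i j. L i j = {k\<in>J. \<exists>x y. \<forall>m<d. \<phi> k m = x * \<phi> i m + y * \<phi> j m}"
    and fJ: "finite J"
    and b: "\<And>m. m < d \<Longrightarrow> b m \<in> J"
    and \<phi>b: "\<And>m l. m < d \<Longrightarrow> l < d \<Longrightarrow> \<phi> (b l) m = (if m = l then 1 else 0)"
    and indep: "\<And>i j x y. i \<in> J \<Longrightarrow> j \<in> J \<Longrightarrow> i \<noteq> j \<Longrightarrow>
      \<forall>m<d. x * \<phi> i m + y * \<phi> j m = 0 \<Longrightarrow> x = 0 \<and> y = 0"
    and \<omega>: "\<And>j. j \<in> J \<Longrightarrow> \<omega> j > 0"
    and \<delta>: "\<delta> > 0"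
    and rich: "\<And>i. i \<in> J \<Longrightarrow>
      \<delta> * sum \<omega> J * \<omega> i \<le> (\<Sum>j\<in>J - {i}. \<omega> i * \<omega> j * (1 - (\<omega> i + \<omega> j) / sum \<omega> (L i j)))"
  shows "real d \<le> 24 / \<delta>\<^sup>2"
proof (cases "J = {}")
  case True
  then have "d = 0" using b by fastforce
  then show ?thesis by simp
next
  case False
  define \<Omega> where "\<Omega> = sum \<omega> J"
  have \<Omega>: "\<Omega> > 0" unfolding \<Omega>_def by (rule sum_pos[OF fJ False \<omega>])
  have LJ: "L i j \<subseteq> J" for i j by (auto simp: L_def)
  have fL: "finite (L i j)" for i j by (rule finite_subset[OF LJ fJ])
  have Li: "i \<in> L i j" if "i \<in> J" for i j
  proof -
    have "\<forall>m<d. \<phi> i m = 1 * \<phi> i m + 0 * \<phi> j m" by simp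
    then show ?thesis unfolding L_def using that by blast
  qed
  have Lsym: "L i j = L j i" for i j
    unfolding L_def by (metis (no_types, opaque_lifting) add.commute)
  have Lj: "j \<in> L i j" if "j \<in> J" for i j using Li[OF that] Lsym by blast
  \<comment> \<open>A zero coefficient would make two distinct points dependent. Nonzero
    coefficients are needed because a row must not vanish on its support.\<close>
  have coeffs: "\<exists>x y. x \<noteq> 0 \<and> y \<noteq> 0 \<and> (\<forall>m<d. \<phi> k m = x * \<phi> i m + y * \<phi> j m)"
    if ijk: "i \<in> J" "j \<in> J" "k \<in> L i j" "k \<noteq> i" "k \<noteq> j" for i j k
  proof -
    obtain x y where xy: "\<And>m. m < d \<Longrightarrow> \<phi> k m = x * \<phi> i m + y * \<phi> j m" and k: "k \<in> J"
      using ijk(3) unfolding L_def by blast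
    have "x \<noteq> 0" using indep[of k j 1 "- y"] xy ijk k by auto
    moreover have "y \<noteq> 0" using indep[of k i 1 "- x"] xy ijk k by auto
    ultimately show ?thesis using xy by blast
  qed
  \<comment> \<open>Exchange property: a line is determined by any two of its points.\<close>
  have Leq: "L i k = L i j" if ij: "i \<in> J" "j \<in> J" "k \<in> L i j" "k \<noteq> i" for i j k
  proof (cases "k = j")
    case False
    obtain x y where y: "y \<noteq> 0" and xy: "\<And>m. m < d \<Longrightarrow> \<phi> k m = x * \<phi> i m + y * \<phi> j m"
      using coeffs[OF ij False] by blast
    show ?thesis
    proof (intro subset_antisym subsetI)
      fix l assume "l \<in> L i k"
      then obtain u v where l: "l \<in> J" "\<And>m. m < d \<Longrightarrow> \<phi> l m = u * \<phi> i m + v * \<phi> k m"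
        by (auto simp: L_def)
      then have "\<forall>m<d. \<phi> l m = (u + v * x) * \<phi> i m + (v * y) * \<phi> j m"
        using xy by (simp add: algebra_simps)
      then show "l \<in> L i j" unfolding L_def using l by blast
    next
      fix l assume "l \<in> L i j"
      then obtain u v where l: "l \<in> J" "\<And>m. m < d \<Longrightarrow> \<phi> l m = u * \<phi> i m + v * \<phi> j m"
        by (auto simp: L_def)
      then have "\<forall>m<d. \<phi> l m = (u - v * x / y) * \<phi> i m + (v / y) * \<phi> k m"
        using xy y by (simp add: field_simps)
      then show "l \<in> L i k" unfolding L_def using l by blast
    qed
  qed simp
  define R where "R = {{i, j, k} | i j k. i \<in> J \<and> j \<in> J \<and> i \<noteq> j \<and> k \<in> L i j \<and> k \<noteq> i \<and> k \<noteq> j}"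
  \<comment> \<open>For \<open>t\<close> in \<open>R\<close> all members of this union coincide, so
    it is the line carrying \<open>t\<close>, obtained without choosing a pair.\<close>
  define line where "line t = (\<Union>i\<in>t. \<Union>j\<in>t - {i}. L i j)" for t
  have RJ: "t \<subseteq> J" if "t \<in> R" for t using that LJ unfolding R_def by blast
  have fR: "finite R" by (rule finite_subset[of _ "Pow J"]) (use RJ fJ in auto)
  have cardR: "card t = 3" if "t \<in> R" for t using that unfolding R_def by auto
  have triple: "L p q = L i j" if t: "i \<in> J" "j \<in> J" "i \<noteq> j" "k \<in> L i j" "k \<noteq> i" "k \<noteq> j"
    and pq: "p \<in> {i, j, k}" "q \<in> {i, j, k}" "p \<noteq> q" for i j k p q
  proof -
    have "L i k = L i j" by (rule Leq[OF t(1,2,4,5)])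
    moreover have "L j k = L j i"
    proof (rule Leq[OF t(2,1) _ t(6)])
      show "k \<in> L j i" using t(4) unfolding Lsym[of j i] .
    qed
    ultimately have "L i k = L i j" "L k i = L i j" "L j k = L i j" "L k j = L i j" "L j i = L i j"
      using Lsym[of j i] Lsym[of k i] Lsym[of k j] by simp_all
    then show ?thesis using pq by auto
  qed
  have lineR: "line t = L p q" "t \<subseteq> L p q" if t: "t \<in> R" and p: "p \<in> t" and q: "q \<in> t" and pq: "p \<noteq> q" for t p q
  proof -
    obtain i j k where ijk: "i \<in> J" "j \<in> J" "i \<noteq> j" "k \<in> L i j" "k \<noteq> i" "k \<noteq> j" and teq: "t = {i, j, k}"
      using t unfolding R_def by blast
    have eq: "L p' q' = L i j" if "p' \<in> t" "q' \<in> t" "p' \<noteq> q'" for p' q'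
      using triple[OF ijk] that unfolding teq by blast
    have "line t = L i j"
      unfolding line_def using eq p q pq by blast
    then show "line t = L p q" using eq[OF p q pq] by simp
    show "t \<subseteq> L p q" unfolding eq[OF p q pq] using ijk Li Lj teq by auto
  qed
  have "\<exists>\<alpha>. (\<forall>j\<in>t. \<alpha> j \<noteq> 0) \<and> (\<forall>m<d. (\<Sum>j\<in>t. \<alpha> j * \<phi> j m) = 0)" if t: "t \<in> R" for t
  proof -
    obtain i j k where ijk: "i \<in> J" "j \<in> J" "i \<noteq> j" "k \<in> L i j" "k \<noteq> i" "k \<noteq> j" and teq: "t = {i, j, k}"
      using t unfolding R_def by blast
    obtain x y where xy: "x \<noteq> 0" "y \<noteq> 0" "\<And>m. m < d \<Longrightarrow> \<phi> k m = x * \<phi> i m + y * \<phi> j m"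
      using coeffs[of i j k] ijk by blast
    \<comment> \<open>The row encodes
      \<open>x * \<phi> i m + y * \<phi> j m - \<phi> k m = 0\<close>; the default value
      \<open>- 1\<close> is the coefficient at \<open>k\<close>.\<close>
    show ?thesis
      by (rule exI[of _ "(\<lambda>_. - 1)(i := x, j := y)"]) (use ijk teq xy in auto)
  qed
  then obtain \<alpha> where \<alpha>0: "\<And>t j. t \<in> R \<Longrightarrow> j \<in> t \<Longrightarrow> \<alpha> t j \<noteq> 0"
    and \<alpha>: "\<And>t m. t \<in> R \<Longrightarrow> m < d \<Longrightarrow> (\<Sum>j\<in>t. \<alpha> t j * \<phi> j m) = 0"
    by metis
  define r where "r t = prod \<omega> t / sum \<omega> (line t)" for t
  have L_pos: "sum \<omega> (L i j) > 0" if "i \<in> J" for i j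
    by (rule sum_pos[OF fL]) (use that Li LJ \<omega> in blast)+
  have rpos: "r t > 0" if t: "t \<in> R" for t
  proof -
    obtain i j where ij: "i \<in> t" "j \<in> t" "i \<noteq> j" using t unfolding R_def by blast
    have "prod \<omega> t > 0" using RJ[OF t] \<omega> by (intro prod_pos) auto
    then show ?thesis unfolding r_def lineR(1)[OF t ij]
      using L_pos ij RJ[OF t] by (intro divide_pos_pos) auto
  qed
  define n where "n i j = \<omega> i * \<omega> j * (1 - (\<omega> i + \<omega> j) / sum \<omega> (L i j))" for i j
  \<comment> \<open>The triples through \<open>i\<close> and \<open>j\<close> correspond to the
    remaining points of their line. Division by the weight of the line turns the sum of their
    weights into the fraction occurring in \<open>n\<close>.\<close>
  have pair: "(\<Sum>t\<in>{t\<in>R. i \<in> t \<and> j \<in> t}. r t) = n i j" if ij: "i \<in> J" "j \<in> J" "i \<noteq> j" for i j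
  proof -
    let ?h = "\<lambda>k. {i, j, k}"
    have img: "{t\<in>R. i \<in> t \<and> j \<in> t} = ?h ` (L i j - {i, j})"
    proof (intro subset_antisym subsetI)
      fix t assume "t \<in> {t\<in>R. i \<in> t \<and> j \<in> t}"
      then have t: "t \<in> R" "i \<in> t" "j \<in> t" by auto
      have "card (t - {i, j}) = 1"
        using cardR[OF t(1)] t ij by (subst card_Diff_subset) auto
      then obtain k where k: "t - {i, j} = {k}" by (auto simp: card_1_singleton_iff)
      then have "t = {i, j, k}" "k \<in> L i j - {i, j}" using t lineR(2)[OF t ij(3)] by auto
      then show "t \<in> ?h ` (L i j - {i, j})" by blast
    next
      fix t assume "t \<in> ?h ` (L i j - {i, j})"
      then show "t \<in> {t\<in>R. i \<in> t \<and> j \<in> t}" unfolding R_def using ij by blast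
    qed
    have "(\<Sum>t\<in>{t\<in>R. i \<in> t \<and> j \<in> t}. r t) = (\<Sum>k\<in>L i j - {i, j}. r {i, j, k})"
      unfolding img by (subst sum.reindex) (auto simp: inj_on_def)
    also have "\<dots> = (\<Sum>k\<in>L i j - {i, j}. \<omega> i * \<omega> j / sum \<omega> (L i j) * \<omega> k)"
    proof (rule sum.cong[OF refl])
      fix k assume k: "k \<in> L i j - {i, j}"
      then have "{i, j, k} \<in> R" unfolding R_def using ij by blast
      then have "line {i, j, k} = L i j" using lineR(1)[of "{i, j, k}" i j] ij by blast
      then show "r {i, j, k} = \<omega> i * \<omega> j / sum \<omega> (L i j) * \<omega> k"
        unfolding r_def using k ij by auto
    qed
    also have "\<dots> = \<omega> i * \<omega> j / sum \<omega> (L i j) * sum \<omega> (L i j - {i, j})"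
      by (simp add: sum_distrib_left)
    also have "sum \<omega> (L i j - {i, j}) = sum \<omega> (L i j) - (\<omega> i + \<omega> j)"
      using sum_diff[OF fL, of "{i, j}" i j \<omega>] Li[OF ij(1)] Lj[OF ij(2)] ij by simp
    also have "\<omega> i * \<omega> j / sum \<omega> (L i j) * (sum \<omega> (L i j) - (\<omega> i + \<omega> j)) = n i j"
      unfolding n_def using L_pos[OF ij(1), of j] by (simp add: field_simps)
    finally show ?thesis .
  qed
  have n_le: "n i j \<le> \<omega> i * \<omega> j" if ij: "i \<in> J" "j \<in> J" for i j
  proof -
    have "(\<omega> i + \<omega> j) / sum \<omega> (L i j) \<ge> 0"
      using L_pos[OF ij(1), of j] \<omega>[OF ij(1)] \<omega>[OF ij(2)] by simp
    then show ?thesis unfolding n_def using \<omega>[OF ij(1)] \<omega>[OF ij(2)]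
      by (intro mult_left_le) auto
  qed
  define k where "k j = (\<Sum>t\<in>{t\<in>R. j \<in> t}. r t / card t)" for j
  \<comment> \<open>A triple through \<open>i\<close> is counted once for each of its two other
    points, and \<open>2 * r t\<close> is six times its share \<open>r t / 3\<close> in
    \<open>k i\<close>.\<close>
  have kn: "6 * k i = (\<Sum>j\<in>J - {i}. n i j)" if i: "i \<in> J" for i
  proof -
    have "(\<Sum>j\<in>J - {i}. n i j) = (\<Sum>j\<in>J - {i}. \<Sum>t\<in>{t\<in>{t\<in>R. i \<in> t}. j \<in> t}. r t)"
    proof (rule sum.cong[OF refl])
      fix j assume "j \<in> J - {i}"
      then have j: "j \<in> J" "i \<noteq> j" by auto
      show "n i j = (\<Sum>t\<in>{t\<in>{t\<in>R. i \<in> t}. j \<in> t}. r t)"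
        using pair[OF i j] by simp
    qed
    also have "\<dots> = (\<Sum>t\<in>{t\<in>R. i \<in> t}. \<Sum>j\<in>{j\<in>J - {i}. j \<in> t}. r t)"
      by (rule sum.swap_restrict) (use fJ fR in auto)
    also have "\<dots> = (\<Sum>t\<in>{t\<in>R. i \<in> t}. 6 * (r t / card t))"
    proof (rule sum.cong[OF refl])
      fix t assume "t \<in> {t\<in>R. i \<in> t}"
      then have t: "t \<in> R" "i \<in> t" by auto
      have "{j\<in>J - {i}. j \<in> t} = t - {i}" using RJ[OF t(1)] by auto
      then show "(\<Sum>j\<in>{j\<in>J - {i}. j \<in> t}. r t) = 6 * (r t / card t)"
        using cardR[OF t(1)] t(2) by (simp add: card_Diff_singleton)
    qed
    finally show ?thesis by (simp add: k_def sum_distrib_left)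
  qed
  have k_ge: "\<delta> * \<Omega> * \<omega> i / 6 \<le> k i" if i: "i \<in> J" for i
    using rich[OF i] kn[OF i] unfolding n_def \<Omega>_def by simp
  have kpos: "k i > 0" if i: "i \<in> J" for i
  proof -
    have "0 < \<delta> * \<Omega> * \<omega> i / 6" using \<delta> \<Omega> \<omega>[OF i] by simp
    then show ?thesis using k_ge[OF i] by linarith
  qed
  have total: "(\<Sum>t\<in>R. r t) \<le> \<Omega>\<^sup>2 / 6"
  proof -
    have "(\<Sum>i\<in>J. k i) = (\<Sum>t\<in>R. \<Sum>i\<in>{i\<in>J. i \<in> t}. r t / card t)"
      unfolding k_def by (rule sum.swap_restrict[OF fJ fR])
    also have "\<dots> = (\<Sum>t\<in>R. r t)"
    proof (rule sum.cong[OF refl])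
      fix t assume t: "t \<in> R"
      have "{i\<in>J. i \<in> t} = t" using RJ[OF t] by auto
      then show "(\<Sum>i\<in>{i\<in>J. i \<in> t}. r t / card t) = r t" using cardR[OF t] by simp
    qed
    finally have "6 * (\<Sum>t\<in>R. r t) = (\<Sum>i\<in>J. 6 * k i)"
      by (simp flip: sum_distrib_left)
    also have "\<dots> = (\<Sum>i\<in>J. \<Sum>j\<in>J - {i}. n i j)"
      by (rule sum.cong) (simp_all add: kn)
    also have "\<dots> \<le> (\<Sum>i\<in>J. \<Sum>j\<in>J - {i}. \<omega> i * \<omega> j)"
      by (intro sum_mono n_le) auto
    also have "\<dots> \<le> (\<Sum>i\<in>J. \<Sum>j\<in>J. \<omega> i * \<omega> j)"
      using \<omega> fJ by (intro sum_mono sum_mono2) (auto simp: less_imp_le)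
    also have "\<dots> = \<Omega>\<^sup>2" by (simp add: \<Omega>_def power2_eq_square sum_product)
    finally show ?thesis by simp
  qed
  \<comment> \<open>The value of \<open>\<kappa>\<close> comes from multiplying \<open>k_ge\<close>
    for \<open>i\<close> and for \<open>j\<close>, which bounds
    \<open>\<omega> i * \<omega> j\<close> by
    \<open>36 / (\<delta>\<^sup>2 * \<Omega>\<^sup>2) * (k i * k j)\<close>.\<close>
  have "real d \<le> 4 * (36 / (\<delta>\<^sup>2 * \<Omega>\<^sup>2)) * (\<Sum>t\<in>R. r t)"
  proof (rule design_bound[where S = "\<lambda>t. t" and f = "\<lambda>m j. \<phi> j m" and J = J and k = k and b = b])
    show "36 / (\<delta>\<^sup>2 * \<Omega>\<^sup>2) > 0" using \<delta> \<Omega> by simp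
    show "(\<Sum>t\<in>{t\<in>R. i \<in> t \<and> j \<in> t}. r t) \<le> 36 / (\<delta>\<^sup>2 * \<Omega>\<^sup>2) * (k i * k j)"
      if ij: "i \<in> J" "j \<in> J" "i \<noteq> j" for i j
    proof -
      have "\<omega> i * \<omega> j = 36 / (\<delta>\<^sup>2 * \<Omega>\<^sup>2) * ((\<delta> * \<Omega> * \<omega> i / 6) * (\<delta> * \<Omega> * \<omega> j / 6))"
        using \<delta> \<Omega> by (simp add: field_simps power2_eq_square)
      also have "\<dots> \<le> 36 / (\<delta>\<^sup>2 * \<Omega>\<^sup>2) * (k i * k j)"
        using k_ge kpos[OF ij(1)] \<delta> \<Omega> \<omega> ij
        by (intro mult_left_mono mult_mono) (auto simp: less_imp_le)
      finally show ?thesis using pair[OF ij] n_le[OF ij(1,2)] by simp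
    qed
    show "t \<noteq> {}" if "t \<in> R" for t using cardR[OF that] by auto
  qed (use fJ fR RJ \<alpha>0 rpos kpos \<alpha> b \<phi>b in \<open>auto simp: k_def\<close>)
  also have "\<dots> \<le> 4 * (36 / (\<delta>\<^sup>2 * \<Omega>\<^sup>2)) * (\<Omega>\<^sup>2 / 6)"
    by (intro mult_left_mono total) simp
  also have "\<dots> = 24 / \<delta>\<^sup>2" using \<Omega> by simp
  finally show ?thesis .
qed

section \<open>Coordinates in the span of a finite set of vectors\<close>

lemma cspan_pair:
  assumes pq: "p \<in> carrier_vec n" "q \<in> carrier_vec n" and v: "v \<in> cspan n {p, q}"
  shows "\<exists>x y. \<forall>i<n. v $ i = x * p $ i + y * q $ i"
proof -
  interpret vec_space "TYPE(complex)" n .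
  obtain a where a: "v = lincomb a {p, q}"
    using v finite_span[of "{p, q}"] pq by auto
  have "v $ i = (\<Sum>u\<in>{p, q}. a u * u $ i)" if "i < n" for i
    unfolding a using lincomb_index[OF that, of "{p, q}" a] pq by auto
  then have v_eq: "\<forall>i<n. v $ i = (\<Sum>u\<in>{p, q}. a u * u $ i)" by blast
  show ?thesis
  proof (cases "p = q")
    case True
    then have "\<forall>i<n. v $ i = a p * p $ i + 0 * q $ i" using v_eq by simp
    then show ?thesis by blast
  next
    case False
    then have "\<forall>i<n. v $ i = a p * p $ i + a q * q $ i" using v_eq by simp
    then show ?thesis by blast
  qed
qed

lemma clin_indpt_unique:
  assumes fU: "finite U" and U: "U \<subseteq> carrier_vec n" and ind: "clin_indpt n U"
    and c: "\<And>i. i < n \<Longrightarrow> (\<Sum>u\<in>U. c u * u $ i) = 0" and u: "u \<in> U"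
  shows "c u = 0"
proof (rule ccontr)
  interpret vec_space "TYPE(complex)" n .
  assume "c u \<noteq> 0"
  moreover have "lincomb c U = 0\<^sub>v n"
    by (rule eq_vecI) (use U c lincomb_index[OF _ U] lincomb_dim[OF fU U] in auto)
  ultimately have "lin_dep U"
    unfolding lin_dep_def using fU u by auto
  then show False using ind by blast
qed

text \<open>A maximal independent subset of \<open>T\<close> is a basis of the span. Choosing it
  inside \<open>T\<close> yields the points \<open>b\<close> required by the weighted bound; the
  last property transfers linear relations between vectors to their coordinates.\<close>

lemma cspan_coordinates:
  assumes fT: "finite T" and T: "T \<subseteq> carrier_vec n"
  obtains b :: "nat \<Rightarrow> complex vec" and \<phi> :: "complex vec \<Rightarrow> nat \<Rightarrow> complex"
  where "\<And>m. m < dim_cspan n T \<Longrightarrow> b m \<in> T"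
    and "\<And>m l. m < dim_cspan n T \<Longrightarrow> l < dim_cspan n T \<Longrightarrow> \<phi> (b l) m = (if m = l then 1 else 0)"
    and "\<And>v i. v \<in> T \<Longrightarrow> i < n \<Longrightarrow> v $ i = (\<Sum>m<dim_cspan n T. \<phi> v m * b m $ i)"
    and "\<And>c m. (\<And>i. i < n \<Longrightarrow> (\<Sum>m<dim_cspan n T. c m * b m $ i) = 0) \<Longrightarrow>
      m < dim_cspan n T \<Longrightarrow> c m = 0"
proof -
  interpret vec_space "TYPE(complex)" n .
  have "lin_indpt {}" unfolding lin_dep_def by auto
  then obtain U where U: "finite U" "maximal U (\<lambda>S. S \<subseteq> T \<and> lin_indpt S)"
    using maximal_exists_superset[OF fT, of "\<lambda>S. S \<subseteq> T \<and> lin_indpt S" "{}"] by auto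
  have UT: "U \<subseteq> T" and li: "lin_indpt U" using U(2) by (auto simp: maximal_def)
  have Uc: "U \<subseteq> carrier_vec n" using UT T by blast
  have dim: "dim_cspan n T = card U" using dim_span[of T U] fT T U by simp
  obtain b where b: "bij_betw b {..<card U} U"
    using ex_bij_betw_nat_finite[OF U(1)] by (auto simp: atLeast0LessThan)
  have sum_b: "(\<Sum>m<card U. g (b m)) = (\<Sum>u\<in>U. g u)" for g :: "complex vec \<Rightarrow> complex"
    by (rule sum.reindex_bij_betw[OF b])
  have span: "\<exists>a. \<forall>i<n. v $ i = (\<Sum>u\<in>U. a u * u $ i)" if v: "v \<in> T" for v
  proof -
    have "v \<in> span U"
    proof (rule ccontr)
      assume nv: "v \<notin> span U"
      then have "v \<notin> U" using span_mem[of U] Uc by auto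
      then have "lin_indpt (U \<union> {v})" using lin_dep_iff_in_span[of U v] li Uc v T nv by auto
      then show False using U(2) v UT \<open>v \<notin> U\<close> unfolding maximal_def by blast
    qed
    then obtain a where "v = lincomb a U" using finite_span[OF U(1)] Uc by auto
    then show ?thesis using lincomb_index[OF _ Uc] by auto
  qed
  then obtain a where a: "\<And>v i. v \<in> T \<Longrightarrow> i < n \<Longrightarrow> v $ i = (\<Sum>u\<in>U. a v u * u $ i)"
    by metis
  show thesis
  proof (rule that[of b "\<lambda>v m. a v (b m)"])
    show bT: "b m \<in> T" if "m < dim_cspan n T" for m
      using b UT that unfolding dim by (auto simp: bij_betw_def)
    show "v $ i = (\<Sum>m<dim_cspan n T. a v (b m) * b m $ i)" if "v \<in> T" "i < n" for v i
      unfolding dim sum_b[of "\<lambda>u. a v u * u $ i"] by (rule a[OF that])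
    show zero: "c m = 0" if c: "\<And>i. i < n \<Longrightarrow> (\<Sum>m<dim_cspan n T. c m * b m $ i) = 0"
      and m: "m < dim_cspan n T" for c m
    proof -
      \<comment> \<open>Independence speaks of coefficients attached to vectors, so \<open>c\<close>
        is moved from indices to basis vectors.\<close>
      define c' where "c' = c \<circ> inv_into {..<card U} b"
      have c': "c' (b l) = c l" if "l < card U" for l
        using b that by (simp add: c'_def bij_betw_def inv_into_f_f)
      have "c' (b m) = 0"
      proof (rule clin_indpt_unique[OF U(1) Uc li])
        show "(\<Sum>u\<in>U. c' u * u $ i) = 0" if "i < n" for i
          unfolding sum_b[of "\<lambda>u. c' u * u $ i", symmetric] using c[OF that] dim c' by simp
        show "b m \<in> U" using b m unfolding dim by (auto simp: bij_betw_def)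
      qed
      then show ?thesis using c' m dim by simp
    qed
    show "a (b l) (b m) = (if m = l then 1 else 0)"
      if m: "m < dim_cspan n T" and l: "l < dim_cspan n T" for m l
    proof -
      have "a (b l) (b m) - (if m = l then 1 else 0) = 0"
      proof (rule zero[of "\<lambda>m. a (b l) (b m) - (if m = l then 1 else 0)", OF _ m])
        fix i assume i: "i < n"
        have "(\<Sum>m<card U. (if m = l then 1 else 0) * b m $ i) = (\<Sum>m<card U. if m = l then b m $ i else 0)"
          by (rule sum.cong) auto
        then have "(\<Sum>m<card U. (if m = l then 1 else 0) * b m $ i) = b l $ i"
          using l dim by simp
        moreover have "(\<Sum>m<card U. a (b l) (b m) * b m $ i) = b l $ i"
          using a[OF bT[OF l] i] sum_b[of "\<lambda>u. a (b l) u * u $ i"] by simp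
        ultimately show "(\<Sum>m<dim_cspan n T. (a (b l) (b m) - (if m = l then 1 else 0)) * b m $ i) = 0"
          unfolding dim by (simp add: left_diff_distrib sum_subtractf)
      qed
      then show ?thesis by simp
    qed
  qed
qed

section \<open>From EK configurations to the weighted bound\<close>

text \<open>The weighted bound applies with \<open>\<delta> / 9\<close>: one factor 3 arises because
  the total weight is at most three times the median, the other because a special pair leaves at
  least a third of the weight of its line. Then \<open>24 * 81 = 1944\<close>.\<close>

lemma partial_EK_dim_bound:
  assumes \<delta>: "0 < \<delta>"
    and T: "\<And>i. i \<in> {1..3} \<Longrightarrow> finite (T i) \<and> T i \<subseteq> carrier_vec n"
    and disj: "disjoint_family_on T {1..3}"
    and ind: "\<And>u v. u \<in> T 1 \<union> T 2 \<union> T 3 \<Longrightarrow> v \<in> T 1 \<union> T 2 \<union> T 3 \<Longrightarrow> u \<noteq> v \<Longrightarrow> clin_indpt n {u, v}"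
    and EK: "partial_EK_configuration n \<delta> T"
  shows "real (dim_cspan n (T 1 \<union> T 2 \<union> T 3)) \<le> 1944 / \<delta>\<^sup>2"
proof -
  define J where "J = T 1 \<union> T 2 \<union> T 3"
  define d where "d = dim_cspan n J"
  have I: "{1..3::nat} = {1, 2, 3}" by auto
  have JU: "J = (\<Union>i\<in>{1..3}. T i)" unfolding J_def I by auto
  have fT: "finite (T i)" if "i \<in> {1..3}" for i using T that by blast
  have fJ: "finite J" unfolding JU using fT by blast
  have Jc: "J \<subseteq> carrier_vec n" unfolding JU using T by blast
  have TJ: "T i \<subseteq> J" if "i \<in> {1..3}" for i using that unfolding JU by blast
  have same: "i = j" if "p \<in> T i" "p \<in> T j" "i \<in> {1..3}" "j \<in> {1..3}" for p i j
    using disj that unfolding disjoint_family_on_def by blast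
  obtain b \<phi> where b: "\<And>m. m < d \<Longrightarrow> b m \<in> J"
    and \<phi>b: "\<And>m l. m < d \<Longrightarrow> l < d \<Longrightarrow> \<phi> (b l) m = (if m = l then 1 else 0)"
    and \<phi>: "\<And>v i. v \<in> J \<Longrightarrow> i < n \<Longrightarrow> v $ i = (\<Sum>m<d. \<phi> v m * b m $ i)"
    and zero: "\<And>c m. (\<And>i. i < n \<Longrightarrow> (\<Sum>m<d. c m * b m $ i) = 0) \<Longrightarrow> m < d \<Longrightarrow> c m = 0"
    using cspan_coordinates[OF fJ Jc] unfolding d_def by blast
  define L where "L i j = {k\<in>J. \<exists>x y. \<forall>m<d. \<phi> k m = x * \<phi> i m + y * \<phi> j m}" for i j
  have inL: "v \<in> L p q" if pqv: "p \<in> J" "q \<in> J" "v \<in> J" "v \<in> cspan n {p, q}" for p q v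
  proof -
    obtain x y where xy: "\<And>i. i < n \<Longrightarrow> v $ i = x * p $ i + y * q $ i"
      using cspan_pair[of p n q v] pqv Jc by blast
    have "\<phi> v m - (x * \<phi> p m + y * \<phi> q m) = 0" if "m < d" for m
    proof (rule zero[of "\<lambda>m. \<phi> v m - (x * \<phi> p m + y * \<phi> q m)", OF _ that])
      fix i assume "i < n"
      then show "(\<Sum>m<d. (\<phi> v m - (x * \<phi> p m + y * \<phi> q m)) * b m $ i) = 0"
        using xy[of i] \<phi>[of v i] \<phi>[of p i] \<phi>[of q i] pqv
        by (simp add: algebra_simps sum.distrib sum_subtractf sum_distrib_left)
    qed
    then have "\<forall>m<d. \<phi> v m = x * \<phi> p m + y * \<phi> q m" by simp
    then show ?thesis unfolding L_def using pqv by blast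
  qed
  have indep: "x = 0 \<and> y = 0"
    if pq: "p \<in> J" "q \<in> J" "p \<noteq> q" and xy: "\<forall>m<d. x * \<phi> p m + y * \<phi> q m = 0" for p q x y
  proof -
    let ?c = "\<lambda>u. if u = p then x else y"
    have "(\<Sum>u\<in>{p, q}. ?c u * u $ i) = 0" if "i < n" for i
    proof -
      have "(\<Sum>u\<in>{p, q}. ?c u * u $ i) = (\<Sum>m<d. (x * \<phi> p m + y * \<phi> q m) * b m $ i)"
        using \<phi>[OF pq(1) that] \<phi>[OF pq(2) that] pq(3)
        by (simp add: sum.distrib sum_distrib_left distrib_right mult.assoc)
      also have "\<dots> = 0" using xy by simp
      finally show ?thesis .
    qed
    then have "?c p = 0 \<and> ?c q = 0"
      using clin_indpt_unique[of "{p, q}" n ?c] ind pq Jc unfolding J_def by blast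
    then show ?thesis using pq by simp
  qed
  \<comment> \<open>\<open>a\<close> is the median of the three cardinalities.\<close>
  define x y z where "x = card (T 1)" and "y = card (T 2)" and "z = card (T 3)"
  define a where "a = max (min x y) (min (max x y) z)"
  \<comment> \<open>Of any two of three numbers, the larger is at least the median and the smaller
    at most the median.\<close>
  have median: "card (T k) \<le> a \<and> a \<le> card (T j)"
    if ijk: "{i, j, k} = {1..3}" and le: "card (T k) \<le> card (T j)" for i j k :: nat
  proof -
    have "card {i, j, k} = 3" using ijk by simp
    then have "j \<noteq> k" by (auto simp: card_insert_if split: if_splits)
    moreover have "j \<in> {1, 2, 3}" "k \<in> {1, 2, 3}" using ijk unfolding I by blast+
    ultimately consider "j = 1" "k = 2" | "j = 1" "k = 3" | "j = 2" "k = 1" | "j = 2" "k = 3"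
      | "j = 3" "k = 1" | "j = 3" "k = 2"
      by (elim insertE emptyE) simp_all
    then show ?thesis
      by cases (use le in \<open>simp_all add: a_def x_def y_def z_def min_def max_def\<close>)
  qed
  define w where "w i = min 1 (real a / card (T i))" for i
  \<comment> \<open>By disjointness, a point of \<open>J\<close> has exactly one summand that can be
    nonzero, the one for its own class.\<close>
  define \<omega> where "\<omega> p = (\<Sum>i\<in>{1..3}. if p \<in> T i then w i else 0)" for p
  have \<omega>w: "\<omega> p = w i" if p: "p \<in> T i" and i: "i \<in> {1..3}" for p i
  proof -
    have "\<omega> p = (\<Sum>j\<in>{1..3}. if j = i then w j else 0)"
      unfolding \<omega>_def by (rule sum.cong) (use same p i in auto)
    also have "\<dots> = w i" using i by simp
    finally show ?thesis .
  qed
  \<comment> \<open>Once the denominator is cleared, an empty \<open>T j\<close> would satisfy the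
    inequality; the last clause keeps the information that it cannot be empty.\<close>
  have EKp: "\<exists>j k. {i, j, k} = {1..3} \<and> card (T k) \<le> card (T j) \<and>
      \<delta> * card (T j) \<le> card {q \<in> T j. \<exists>v\<in>T k. v \<in> cspan n {p, q}} \<and>
      {q \<in> T j. \<exists>v\<in>T k. v \<in> cspan n {p, q}} \<noteq> {}"
    if i: "i \<in> {1..3}" and p: "p \<in> T i" for i p
  proof -
    obtain j k where jk: "{i, j, k} = {1..3}" "card (T k) \<le> card (T j)"
      and ge: "real (card {q \<in> T j. \<exists>v\<in>T k. v \<in> cspan n {p, q}}) / real (card (T j)) \<ge> \<delta>"
      using EK i p unfolding partial_EK_configuration_def by blast
    have pos: "card (T j) > 0" using ge \<delta> by (cases "card (T j) = 0") auto
    then have "\<delta> * card (T j) \<le> card {q \<in> T j. \<exists>v\<in>T k. v \<in> cspan n {p, q}}"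
      using ge by (simp add: field_simps)
    moreover have "{q \<in> T j. \<exists>v\<in>T k. v \<in> cspan n {p, q}} \<noteq> {}"
      using ge \<delta> by (metis card.empty div_0 not_le of_nat_0)
    ultimately show ?thesis using jk by blast
  qed
  \<comment> \<open>A special partner of \<open>p\<close> comes with a point of the smaller class
    \<open>T k\<close>, whose size is at most \<open>a\<close>.\<close>
  have apos: "a > 0" if p: "p \<in> J" for p
  proof -
    obtain i where i: "i \<in> {1..3}" "p \<in> T i" using p unfolding JU by blast
    obtain j k where jk: "{i, j, k} = {1..3}" "card (T k) \<le> card (T j)"
      and ne: "{q \<in> T j. \<exists>v\<in>T k. v \<in> cspan n {p, q}} \<noteq> {}"
      using EKp[OF i] by blast
    have "k \<in> {1..3}" using jk(1) by blast
    then have "card (T k) > 0" using ne fT[of k] by (auto simp: card_gt_0_iff)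
    then show ?thesis using median[OF jk] by simp
  qed
  have cpos: "card (T i) > 0" if "p \<in> T i" "i \<in> {1..3}" for p i
    using that fT[of i] by (auto simp: card_gt_0_iff)
  have \<omega>: "0 < \<omega> p" "\<omega> p \<le> 1" if p: "p \<in> J" for p
  proof -
    obtain i where i: "i \<in> {1..3}" "p \<in> T i" using p unfolding JU by blast
    show "0 < \<omega> p" "\<omega> p \<le> 1"
      unfolding \<omega>w[OF i(2,1)] w_def using apos[OF p] cpos[OF i(2,1)] by auto
  qed
  have \<Omega>: "sum \<omega> J \<le> 3 * a"
  proof -
    have "sum \<omega> J = (\<Sum>i\<in>{1..3}. sum \<omega> (T i))"
      unfolding JU by (rule sum.UNION_disjoint) (use fT disj in \<open>auto simp: disjoint_family_on_def\<close>)
    also have "\<dots> \<le> (\<Sum>i\<in>{1..3::nat}. real a)"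
    proof (rule sum_mono)
      fix i :: nat assume i: "i \<in> {1..3}"
      have "sum \<omega> (T i) = card (T i) * w i" using \<omega>w[OF _ i] by simp
      also have "\<dots> \<le> card (T i) * (a / card (T i))"
        unfolding w_def by (intro mult_left_mono) auto
      \<comment> \<open>Only an inequality, since for an empty class the left side is
        \<open>0\<close>.\<close>
      also have "\<dots> \<le> a" by simp
      finally show "sum \<omega> (T i) \<le> a" .
    qed
    finally show ?thesis by simp
  qed
  have fL: "finite (L p q)" for p q unfolding L_def using fJ by simp
  have ends: "p \<in> L p q" "q \<in> L p q" if pq: "p \<in> J" "q \<in> J" for p q
  proof -
    have "\<forall>m<d. \<phi> p m = 1 * \<phi> p m + 0 * \<phi> q m" "\<forall>m<d. \<phi> q m = 0 * \<phi> p m + 1 * \<phi> q m" by simp_all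
    then show "p \<in> L p q" "q \<in> L p q" unfolding L_def using pq by blast+
  qed
  have \<omega>L: "sum \<omega> X \<le> sum \<omega> (L p q)" if "X \<subseteq> L p q" for X p q
    using that \<omega>(1) by (intro sum_mono2 fL) (auto simp: L_def less_imp_le)
  have rich: "\<delta> / 9 * sum \<omega> J * \<omega> p
      \<le> (\<Sum>q\<in>J - {p}. \<omega> p * \<omega> q * (1 - (\<omega> p + \<omega> q) / sum \<omega> (L p q)))" if p: "p \<in> J" for p
  proof -
    obtain i where i: "i \<in> {1..3}" "p \<in> T i" using p unfolding JU by blast
    define S where "S j k = {q \<in> T j. \<exists>v\<in>T k. v \<in> cspan n {p, q}}" for j k
    obtain j k where jk: "{i, j, k} = {1..3}" "card (T k) \<le> card (T j)"
      and ge: "\<delta> * card (T j) \<le> card (S j k)" and ne: "S j k \<noteq> {}"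
      using EKp[OF i] unfolding S_def by blast
    have j: "j \<in> {1..3}" and k: "k \<in> {1..3}" using jk by auto
    have dist: "i \<noteq> j" "i \<noteq> k" "j \<noteq> k"
    proof -
      have "card {i, j, k} = 3" using jk by simp
      then show "i \<noteq> j" "i \<noteq> k" "j \<noteq> k" by (auto simp: card_insert_if split: if_splits)
    qed
    have med: "card (T k) \<le> a" "a \<le> card (T j)" using median[OF jk] by auto
    have wj: "w j * card (T j) = a"
      using med(2) apos[OF p] by (simp add: w_def min_def field_simps)
    have SJ: "S j k \<subseteq> J - {p}" unfolding S_def using TJ[OF j] same[OF i(2) _ i(1) j] dist by auto
    \<comment> \<open>This allows the sum over special partners to be enlarged to a sum over all
      points.\<close>
    have term_nonneg: "0 \<le> \<omega> p * \<omega> q * (1 - (\<omega> p + \<omega> q) / sum \<omega> (L p q))" if q: "q \<in> J - {p}" for q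
    proof -
      have "\<omega> p + \<omega> q \<le> sum \<omega> (L p q)" using \<omega>L[of "{p, q}" p q] ends p q by auto
      moreover have "0 < \<omega> p" "0 < \<omega> q" using \<omega> p q by auto
      ultimately show ?thesis by (intro mult_nonneg_nonneg) (auto simp: field_simps)
    qed
    \<comment> \<open>The third point \<open>v\<close> has weight 1 because its class has at most
      \<open>a\<close> elements. As \<open>\<omega> p\<close> and \<open>\<omega> q\<close> are at
      most 1, they make up at most two thirds of the weight of the line.\<close>
    have term_ge: "\<omega> p * w j / 3 \<le> \<omega> p * \<omega> q * (1 - (\<omega> p + \<omega> q) / sum \<omega> (L p q))" if q: "q \<in> S j k" for q
    proof -
      obtain v where v: "v \<in> T k" "v \<in> cspan n {p, q}" and qT: "q \<in> T j" using q by (auto simp: S_def)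
      have J': "q \<in> J" "v \<in> J" using qT v TJ j k by auto
      have ne: "q \<noteq> p" "v \<noteq> p" "v \<noteq> q"
        using same[OF _ _ _ i(1)] same[OF _ _ k j] qT v(1) i dist j k by blast+
      have wv: "\<omega> v = 1"
        unfolding \<omega>w[OF v(1) k] w_def using med(1) cpos[OF v(1) k] by (simp add: min_def field_simps)
      have "\<omega> p + \<omega> q + 1 \<le> sum \<omega> (L p q)"
        using \<omega>L[of "{p, q, v}" p q] ends[OF p J'(1)] inL[OF p J' v(2)] ne wv by auto
      moreover have "0 < \<omega> p" "\<omega> p \<le> 1" "0 < \<omega> q" "\<omega> q \<le> 1" using \<omega> p J' by auto
      ultimately have "1/3 \<le> 1 - (\<omega> p + \<omega> q) / sum \<omega> (L p q)" by (simp add: field_simps)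
      then have "\<omega> p * \<omega> q * (1/3) \<le> \<omega> p * \<omega> q * (1 - (\<omega> p + \<omega> q) / sum \<omega> (L p q))"
        using \<open>0 < \<omega> p\<close> \<open>0 < \<omega> q\<close> by (intro mult_left_mono) auto
      then show ?thesis using \<omega>w[OF qT j] by simp
    qed
    have "\<delta> / 9 * sum \<omega> J * \<omega> p \<le> \<delta> / 9 * (3 * a) * \<omega> p"
      using \<Omega> \<delta> \<omega>(1)[OF p] by (intro mult_right_mono mult_left_mono) auto
    \<comment> \<open>The class \<open>T j\<close> has at least \<open>a\<close> elements, so its
      total weight is exactly \<open>a\<close>; this turns \<open>a\<close> into a count of
      partners.\<close>
    also have "\<dots> = \<omega> p * w j / 3 * (\<delta> * card (T j))" using wj by simp
    also have "\<dots> \<le> \<omega> p * w j / 3 * card (S j k)"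
      using ge \<omega>(1)[OF p] by (intro mult_left_mono) (auto simp: w_def)
    also have "\<dots> = (\<Sum>q\<in>S j k. \<omega> p * w j / 3)" by simp
    also have "\<dots> \<le> (\<Sum>q\<in>S j k. \<omega> p * \<omega> q * (1 - (\<omega> p + \<omega> q) / sum \<omega> (L p q)))"
      by (rule sum_mono) (rule term_ge)
    also have "\<dots> \<le> (\<Sum>q\<in>J - {p}. \<omega> p * \<omega> q * (1 - (\<omega> p + \<omega> q) / sum \<omega> (L p q)))"
      using fJ SJ term_nonneg by (intro sum_mono2) auto
    finally show ?thesis .
  qed
  have "real d \<le> 24 / (\<delta> / 9)\<^sup>2"
    by (rule weighted_Sylvester_Gallai[OF L_def fJ b \<phi>b indep \<omega>(1) _ rich]) (use \<delta> in auto)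
  then show ?thesis unfolding d_def J_def by (simp add: power_divide)
qed

theorem theorem3p9:
  shows "\<exists>C::real. C > 0 \<and>
    (\<forall>(n::nat) (\<delta>::real) (T :: nat \<Rightarrow> complex vec set).
       0 < \<delta> \<and> \<delta> \<le> 1 \<and>
       (\<forall>i\<in>{1..3}. finite (T i) \<and> T i \<subseteq> carrier_vec n \<and> 0\<^sub>v n \<notin> T i) \<and>
       disjoint_family_on T {1..3} \<and>
       (\<forall>u \<in> T 1 \<union> T 2 \<union> T 3. \<forall>v \<in> T 1 \<union> T 2 \<union> T 3. u \<noteq> v \<longrightarrow> clin_indpt n {u, v}) \<and>
       partial_EK_configuration n \<delta> T
       \<longrightarrow> real (dim_cspan n (T 1 \<union> T 2 \<union> T 3)) \<le> C / \<delta> ^ 3)"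
proof (intro exI[of _ 1944] conjI allI impI, goal_cases)
  case (2 n \<delta> T)
  then have "real (dim_cspan n (T 1 \<union> T 2 \<union> T 3)) \<le> 1944 / \<delta>\<^sup>2"
    by (intro partial_EK_dim_bound) auto
  \<comment> \<open>The quadratic bound implies the cubic one because
    \<open>\<delta> \<le> 1\<close>.\<close>
  also have "\<dots> \<le> 1944 / \<delta> ^ 3"
    using 2 by (intro divide_left_mono power_decreasing) auto
  finally show ?case .
qed simp

end
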